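(* Let $\Delta=\{z\in\mathbb{C}:|z|<1\}$ be the unit disc with its Poincaré metric $\omega_\Delta=i\lambda_\Delta\,dz\wedge d\bar z$, $\lambda_\Delta=(1-|z|^2)^{-2}$. Suppose that $\varphi:\Delta\to\mathbb{R}$ is a positive smooth function such that $dd^c\log\varphi=2\omega_\Delta$ and such that $\|d\log\varphi\|_{\omega_\Delta}$ is constant on $\Delta$. Then $\varphi$ is the pullback of $\lambda_{\mathbf H}$ on the half-plane $\mathbf{H}=\{w\in\mathbb{C}:\operatorname{Re}w<0\}$, where $\lambda_{\mathbf H}(w)=1/|\operatorname{Re}w|^2$: that is, there is a biholomorphism $F:\Delta\to\mathbf{H}$ with $\varphi=\lambda_{\mathbf H}\circ F$. Explicitly, there exist $r>0$ and $\theta\in\mathbb{R}$ such that $$\varphi(z)=r\,\frac{|1+e^{i\theta}z|^4}{(1-|z|^2)^2}\qquad\text{for all }z\in\Delta.$$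
   Context: Conventions: $d^c=\frac{i}{2}(\overline\partial-\partial)$, so that $dd^c u=i\,\frac{\partial^2u}{\partial z\,\partial\bar z}\,dz\wedge d\bar z$; thus $dd^c\log\varphi=2\omega_\Delta$ means $\frac{\partial^2}{\partial z\partial\bar z}\log\varphi=2\lambda_\Delta$ (equivalently, $\frac12\log\varphi$ is a Kähler potential of $\omega_\Delta$). For a real-valued smooth function $u$ and a metric $\omega=i\lambda\,dz\wedge d\bar z$, the length of $du$ is defined by $\|du\|_{\omega}^2=\frac{1}{\lambda}\frac{\partial u}{\partial z}\frac{\partial u}{\partial\bar z}$. The Poincaré metric is the complete hermitian metric of constant Gaussian curvature $-4$, where the curvature of $i\lambda\,dz\wedge d\bar z$ is $-\frac{2}{\lambda}\frac{\partial^2}{\partial z\partial\bar z}\log\lambda$. The function $\lambda_{\mathbf H}(w)=1/|\operatorname{Re}w|^2$ is, up to a positive constant factor, the coefficient of the Poincaré metric of $\mathbf{H}$. *)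

theory Defs
  imports "HOL-Complex_Analysis.Complex_Analysis"
begin

text \<open>
  Smoothness on an open set, by recursion on the order, using all directional
  derivatives. The sets used are open, so \<^term>\<open>at x\<close> only depends on values in the set.
\<close>

primrec times_cont_diff_on ::
    "nat \<Rightarrow> ('a::real_normed_vector \<Rightarrow> 'b::real_normed_vector) \<Rightarrow> 'a set \<Rightarrow> bool" where
  "times_cont_diff_on 0 f S \<longleftrightarrow> continuous_on S f"
| "times_cont_diff_on (Suc k) f S \<longleftrightarrow>
     (\<forall>x\<in>S. f differentiable (at x)) \<and>
     (\<forall>v. times_cont_diff_on k (\<lambda>x. frechet_derivative f (at x) v) S)"

definition smooth_on ::
    "('a::real_normed_vector \<Rightarrow> 'b::real_normed_vector) \<Rightarrow> 'a set \<Rightarrow> bool" where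
  "smooth_on f S \<longleftrightarrow> (\<forall>k. times_cont_diff_on k f S)"

definition d_dz :: "(complex \<Rightarrow> complex) \<Rightarrow> complex \<Rightarrow> complex" where
  "d_dz f z = (frechet_derivative f (at z) 1 - \<i> * frechet_derivative f (at z) \<i>) / 2"

definition d_dzbar :: "(complex \<Rightarrow> complex) \<Rightarrow> complex \<Rightarrow> complex" where
  "d_dzbar f z = (frechet_derivative f (at z) 1 + \<i> * frechet_derivative f (at z) \<i>) / 2"

text \<open>
  Complex-valued differential forms on open subsets of the plane: a 1-form sends a point and
  a tangent vector to a complex number; a 2-form takes two tangent vectors.
\<close>

type_synonym one_form = "complex \<Rightarrow> complex \<Rightarrow> complex"
type_synonym two_form = "complex \<Rightarrow> complex \<Rightarrow> complex \<Rightarrow> complex"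

definition del :: "(complex \<Rightarrow> complex) \<Rightarrow> one_form" where
  "del f = (\<lambda>z v. d_dz f z * v)"

definition delbar :: "(complex \<Rightarrow> complex) \<Rightarrow> one_form" where
  "delbar f = (\<lambda>z v. d_dzbar f z * cnj v)"

text \<open>
  The invariant formula for the exterior derivative of a 1-form, applied to constant
  vector fields \<open>v\<close> and \<open>w\<close>, whose Lie bracket vanishes.
\<close>

definition ext_deriv :: "one_form \<Rightarrow> two_form" where
  "ext_deriv \<alpha> = (\<lambda>z v w. frechet_derivative (\<lambda>x. \<alpha> x w) (at z) v
                          - frechet_derivative (\<lambda>x. \<alpha> x v) (at z) w)"

text \<open>With this normalization, \<open>ddc u = i (d\<^sup>2u / dz dzbar) dz \<and> dzbar\<close>.\<close>

definition dc :: "(complex \<Rightarrow> real) \<Rightarrow> one_form" where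
  "dc u = (\<lambda>z v. \<i> / 2 * (delbar (\<lambda>x. of_real (u x)) z v - del (\<lambda>x. of_real (u x)) z v))"

definition ddc :: "(complex \<Rightarrow> real) \<Rightarrow> two_form" where
  "ddc u = ext_deriv (dc u)"

definition dz_wedge_dzbar :: "complex \<Rightarrow> complex \<Rightarrow> complex" where
  "dz_wedge_dzbar v w = v * cnj w - w * cnj v"

text \<open>A hermitian metric is given by its coefficient \<open>\<lambda>\<close>, standing for the form \<open>i \<lambda> dz \<and> dzbar\<close>.\<close>

definition metric_form :: "(complex \<Rightarrow> real) \<Rightarrow> two_form" where
  "metric_form lam = (\<lambda>z v w. \<i> * of_real (lam z) * dz_wedge_dzbar v w)"

text \<open>
  The length of \<open>du\<close>. For real-valued \<open>u\<close> the two Wirtinger derivatives are conjugate to each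
  other, so their product is a nonnegative real and \<^const>\<open>Re\<close> only changes the type.
\<close>

definition du_norm :: "(complex \<Rightarrow> real) \<Rightarrow> (complex \<Rightarrow> real) \<Rightarrow> complex \<Rightarrow> real" where
  "du_norm lam u z =
     sqrt (1 / lam z * Re (d_dz (\<lambda>x. of_real (u x)) z * d_dzbar (\<lambda>x. of_real (u x)) z))"

definition biholomorphism :: "(complex \<Rightarrow> complex) \<Rightarrow> complex set \<Rightarrow> complex set \<Rightarrow> bool" where
  "biholomorphism F S T \<longleftrightarrow>
     F holomorphic_on S \<and> bij_betw F S T \<and> inv_into S F holomorphic_on T"

definition unit_disc :: "complex set" where
  "unit_disc = {z. norm z < 1}"

definition left_half_plane :: "complex set" where
  "left_half_plane = {w. Re w < 0}"

definition lambda_disc :: "complex \<Rightarrow> real" where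
  "lambda_disc z = (1 - (norm z)\<^sup>2) powi (-2)"

definition lambda_half_plane :: "complex \<Rightarrow> real" where
  "lambda_half_plane w = 1 / \<bar>Re w\<bar>\<^sup>2"

end

theory Submission
  imports Defs
begin

text \<open>
  Write \<open>u = ln \<phi>\<close> and \<open>\<rho> = 1 - |z|\<^sup>2\<close>. Since \<open>-2 ln \<rho>\<close> is a potential of \<open>2 \<omega>\<^sub>\<Delta>\<close>, the function
  \<open>u + 2 ln \<rho>\<close> is harmonic, so its \<open>z\<close>-derivative \<open>h = u\<^sub>z - 2 cnj z / \<rho>\<close> is holomorphic
  (\<open>holomorphic_part_of_potential\<close>). The equation \<open>ddc u = 2 \<omega>\<^sub>\<Delta>\<close> only prescribes the Laplacian of
  \<open>u\<close>; the other half of the Cauchy-Riemann equations for \<open>h\<close> is the equality of the mixed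
  second derivatives (\<open>second_derivative_symmetric\<close>).

  In terms of \<open>h\<close>, constancy of the length of \<open>du\<close> reads \<open>|2 cnj z + \<rho> h|\<^sup>2 = C\<close>. This is an
  identity between real-analytic functions, so \<open>z\<close> and \<open>cnj z\<close> may be replaced in it by
  independent variables \<open>z\<close> and \<open>w\<close> (\<open>polarization\<close>). At \<open>w = 0\<close> it becomes the algebraic
  equation \<open>(2 z + cnj (h 0)) h z = C\<close>, which determines \<open>h\<close> up to the number \<open>h 0\<close>, with
  \<open>|h 0|\<^sup>2 = C\<close>. Putting this back into the real equation forces \<open>C = 4\<close>, hence
  \<open>h z = 2 a / (1 + a z)\<close> with \<open>|a| = 1\<close> (\<open>constant_norm_solution\<close>).

  Now \<open>h\<close> is also the \<open>z\<close>-derivative of \<open>4 ln |1 + a z|\<close>, so \<open>u\<close> differs from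
  \<open>4 ln |1 + a z| - 2 ln \<rho>\<close> by a constant (\<open>integrate_potential\<close>), which is the explicit formula.
  Finally \<open>\<rho> / |1 + a z|\<^sup>2\<close> is the real part of the Cayley transform \<open>(1 - a z) / (1 + a z)\<close>, and
  a negative multiple of that transform is the required map to the left half-plane
  (\<open>cayley_biholomorphism\<close>).
\<close>

section \<open>Symmetry of second derivatives\<close>

text \<open>
  The second difference along \<open>v\<close> and \<open>w\<close> does not change when \<open>v\<close> and \<open>w\<close> are exchanged, whereas
  the mean value theorem, applied first in direction \<open>v\<close> and then in direction \<open>w\<close>, expresses it
  by a mixed derivative in that order. Comparing the two orders gives the symmetry.
\<close>

lemma second_difference_mean_value:
  fixes f :: "'a::real_normed_vector \<Rightarrow> real"
  assumes f: "\<And>y. y \<in> ball x r \<Longrightarrow> (f has_derivative f' y) (at y)"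
    and fv: "\<And>y. y \<in> ball x r \<Longrightarrow> ((\<lambda>y. f' y v) has_derivative fv y) (at y)"
    and t: "t > 0" "t * (norm v + norm w) < r"
  obtains y where "dist x y \<le> t * (norm v + norm w)"
    "f (x + t *\<^sub>R v + t *\<^sub>R w) - f (x + t *\<^sub>R v) - f (x + t *\<^sub>R w) + f x = t\<^sup>2 * fv y w"
proof -
  have bound: "norm (p *\<^sub>R v + q *\<^sub>R w) \<le> t * (norm v + norm w)"
    if "0 \<le> p" "p \<le> t" "0 \<le> q" "q \<le> t" for p q
  proof -
    have "norm (p *\<^sub>R v + q *\<^sub>R w) \<le> p * norm v + q * norm w"
      using that norm_triangle_ineq[of "p *\<^sub>R v" "q *\<^sub>R w"] by simp
    also have "\<dots> \<le> t * norm v + t * norm w"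
      using that by (intro add_mono mult_right_mono) auto
    finally show ?thesis by (simp add: algebra_simps)
  qed
  have inball: "x + p *\<^sub>R v + q *\<^sub>R w \<in> ball x r"
    if "0 \<le> p" "p \<le> t" "0 \<le> q" "q \<le> t" for p q
    using bound[OF that] t(2) norm_minus_cancel[of "p *\<^sub>R v + q *\<^sub>R w"]
    by (simp add: dist_norm algebra_simps)
  define g where "g = (\<lambda>p. f (x + p *\<^sub>R v + t *\<^sub>R w) - f (x + p *\<^sub>R v + 0 *\<^sub>R w))"
  have line_v: "((\<lambda>p. f (x + p *\<^sub>R v + q *\<^sub>R w)) has_real_derivative f' (x + p *\<^sub>R v + q *\<^sub>R w) v) (at p)"
    if "0 \<le> p" "p \<le> t" "0 \<le> q" "q \<le> t" for p q
  proof -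
    note d = f[OF inball[OF that]]
    have "((\<lambda>p. f (x + p *\<^sub>R v + q *\<^sub>R w)) has_derivative (\<lambda>h. f' (x + p *\<^sub>R v + q *\<^sub>R w) (h *\<^sub>R v))) (at p)"
      by (rule has_derivative_compose[where f = "\<lambda>p. x + p *\<^sub>R v + q *\<^sub>R w" and g = f, OF _ d]) (auto intro!: derivative_eq_intros)
    then show ?thesis
      using has_derivative_linear[OF d]
      by (simp add: has_field_derivative_def linear_cmul mult_commute_abs)
  qed
  have line_w: "((\<lambda>q. f' (x + p *\<^sub>R v + q *\<^sub>R w) v) has_real_derivative fv (x + p *\<^sub>R v + q *\<^sub>R w) w) (at q)"
    if "0 \<le> p" "p \<le> t" "0 \<le> q" "q \<le> t" for p q
  proof -
    note d = fv[OF inball[OF that]]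
    have "((\<lambda>q. f' (x + p *\<^sub>R v + q *\<^sub>R w) v) has_derivative (\<lambda>h. fv (x + p *\<^sub>R v + q *\<^sub>R w) (h *\<^sub>R w))) (at q)"
      by (rule has_derivative_compose[where f = "\<lambda>q. x + p *\<^sub>R v + q *\<^sub>R w" and g = "\<lambda>y. f' y v", OF _ d]) (auto intro!: derivative_eq_intros)
    then show ?thesis
      using has_derivative_linear[OF d]
      by (simp add: has_field_derivative_def linear_cmul mult_commute_abs)
  qed
  have dg: "(g has_real_derivative
      f' (x + p *\<^sub>R v + t *\<^sub>R w) v - f' (x + p *\<^sub>R v + 0 *\<^sub>R w) v) (at p)"
    if "0 \<le> p" "p \<le> t" for p
    unfolding g_def using that t by (intro DERIV_diff line_v) auto
  obtain p where p: "0 < p" "p < t"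
    "g t - g 0 = (t - 0) * (f' (x + p *\<^sub>R v + t *\<^sub>R w) v - f' (x + p *\<^sub>R v + 0 *\<^sub>R w) v)"
    using MVT2[OF t(1) dg] by blast
  obtain q where q: "0 < q" "q < t"
    "f' (x + p *\<^sub>R v + t *\<^sub>R w) v - f' (x + p *\<^sub>R v + 0 *\<^sub>R w) v = (t - 0) * fv (x + p *\<^sub>R v + q *\<^sub>R w) w"
    using MVT2[OF t(1) line_w[OF less_imp_le[OF p(1)] less_imp_le[OF p(2)]]] by blast
  show ?thesis
  proof
    show "dist x (x + p *\<^sub>R v + q *\<^sub>R w) \<le> t * (norm v + norm w)"
      using bound[of p q] p q norm_minus_cancel[of "p *\<^sub>R v + q *\<^sub>R w"]
      by (simp add: dist_norm algebra_simps)
    show "f (x + t *\<^sub>R v + t *\<^sub>R w) - f (x + t *\<^sub>R v) - f (x + t *\<^sub>R w) + f x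
        = t\<^sup>2 * fv (x + p *\<^sub>R v + q *\<^sub>R w) w"
      using p(3) unfolding q(3) by (simp add: g_def power2_eq_square)
  qed
qed

text \<open>
  If the two mixed derivatives differed at \<open>x\<close>, by continuity they would stay apart near \<open>x\<close>; but
  both orders of the mean value theorem evaluate the same second difference, at points
  arbitrarily close to \<open>x\<close>.
\<close>

lemma second_derivative_symmetric:
  fixes f :: "'a::real_normed_vector \<Rightarrow> real"
  assumes S: "open S" "x \<in> S"
    and f: "\<And>y. y \<in> S \<Longrightarrow> (f has_derivative f' y) (at y)"
    and fv: "\<And>y. y \<in> S \<Longrightarrow> ((\<lambda>y. f' y v) has_derivative fv y) (at y)"
    and fw: "\<And>y. y \<in> S \<Longrightarrow> ((\<lambda>y. f' y w) has_derivative fw y) (at y)"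
    and cv: "continuous_on S (\<lambda>y. fv y w)" and cw: "continuous_on S (\<lambda>y. fw y v)"
  shows "fv x w = fw x v"
proof (rule ccontr)
  assume ne: "fv x w \<noteq> fw x v"
  define e where "e = dist (fv x w) (fw x v) / 2"
  have e: "e > 0" using ne by (simp add: e_def)
  obtain r where r: "r > 0" "ball x r \<subseteq> S" using S openE by blast
  obtain d1 where d1: "d1 > 0" "\<And>y. y \<in> S \<Longrightarrow> dist y x < d1 \<Longrightarrow> dist (fv y w) (fv x w) < e"
    using cv S e unfolding continuous_on_iff by metis
  obtain d2 where d2: "d2 > 0" "\<And>y. y \<in> S \<Longrightarrow> dist y x < d2 \<Longrightarrow> dist (fw y v) (fw x v) < e"
    using cw S e unfolding continuous_on_iff by metis
  define d where "d = min r (min d1 d2)"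
  have d: "d > 0" using r d1 d2 by (simp add: d_def)
  define t where "t = d / (norm v + norm w + 1)"
  have n: "norm v + norm w + 1 > 0" using norm_ge_zero[of v] norm_ge_zero[of w] by linarith
  have t: "t > 0" using d n by (simp add: t_def)
  have "t * (norm v + norm w + 1) = d" using n by (simp add: t_def)
  then have tb: "t * (norm v + norm w) < d" using t by (simp add: algebra_simps)
  then have tb': "t * (norm v + norm w) < r" "t * (norm w + norm v) < r"
    by (auto simp: d_def add.commute)
  obtain y1 where y1: "dist x y1 \<le> t * (norm v + norm w)"
    "f (x + t *\<^sub>R v + t *\<^sub>R w) - f (x + t *\<^sub>R v) - f (x + t *\<^sub>R w) + f x = t\<^sup>2 * fv y1 w"
    using second_difference_mean_value[of x r f f' v fv t w] f fv r t tb' by blast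
  obtain y2 where y2: "dist x y2 \<le> t * (norm w + norm v)"
    "f (x + t *\<^sub>R w + t *\<^sub>R v) - f (x + t *\<^sub>R w) - f (x + t *\<^sub>R v) + f x = t\<^sup>2 * fw y2 v"
    using second_difference_mean_value[of x r f f' w fw t v] f fw r t tb' by blast
  have "t\<^sup>2 * fv y1 w = t\<^sup>2 * fw y2 v"
    unfolding y1(2)[symmetric] y2(2)[symmetric] by (simp add: algebra_simps)
  then have eq: "fv y1 w = fw y2 v" using t by simp
  have "dist (fv y1 w) (fv x w) < e"
    using y1(1) tb r by (intro d1(2)) (auto simp: d_def dist_commute)
  moreover have "dist (fw y2 v) (fw x v) < e"
    using y2(1) tb r by (intro d2(2)) (auto simp: d_def dist_commute add.commute)
  ultimately have "dist (fv x w) (fw x v) < 2 * e"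
    using eq by (simp add: dist_real_def)
  then show False by (simp add: e_def)
qed

lemma smooth_on_first_derivative:
  assumes "smooth_on f S" "x \<in> S"
  shows "(f has_derivative frechet_derivative f (at x)) (at x)"
proof -
  have "times_cont_diff_on (Suc 0) f S" using assms(1) unfolding smooth_on_def by blast
  then show ?thesis using assms(2) by (simp add: frechet_derivative_works)
qed

lemma smooth_on_derivative:
  assumes "smooth_on f S"
  shows "smooth_on (\<lambda>x. frechet_derivative f (at x) v) S"
  unfolding smooth_on_def
proof
  fix k
  have "times_cont_diff_on (Suc k) f S" using assms unfolding smooth_on_def by (rule spec)
  then show "times_cont_diff_on k (\<lambda>x. frechet_derivative f (at x) v) S" by simp
qed

lemma smooth_on_imp_continuous_on: "smooth_on f S \<Longrightarrow> continuous_on S f"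
  unfolding smooth_on_def by (drule spec[of _ 0]) simp

section \<open>Wirtinger derivatives of real functions\<close>

lemma frechet_derivative_of_real:
  assumes "(u has_derivative U) (at z)"
  shows "frechet_derivative (\<lambda>x. complex_of_real (u x)) (at z) = (\<lambda>v. of_real (U v))"
  by (rule frechet_derivative_at[symmetric])
     (rule bounded_linear.has_derivative[OF bounded_linear_of_real assms])

lemma d_dz_of_real:
  assumes "(u has_derivative U) (at z)"
  shows "d_dz (\<lambda>x. complex_of_real (u x)) z = (of_real (U 1) - \<i> * of_real (U \<i>)) / 2"
    and "d_dzbar (\<lambda>x. complex_of_real (u x)) z = (of_real (U 1) + \<i> * of_real (U \<i>)) / 2"
  by (simp_all add: d_dz_def d_dzbar_def frechet_derivative_of_real[OF assms])

text \<open>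
  A 2-form on the plane is determined by its value on \<open>1\<close> and \<open>\<i>\<close>. There \<open>dc u\<close> is half the
  rotated differential, \<open>dc u = (- u\<^sub>y dx + u\<^sub>x dy) / 2\<close>, so \<open>ddc u\<close> gives half the Laplacian, from
  the second derivatives in the same direction alone.
\<close>

lemma ddc_coefficient:
  assumes S: "open S" "z \<in> S"
    and U: "\<And>x. x \<in> S \<Longrightarrow> (u has_derivative U x) (at x)"
    and UU: "\<And>v. ((\<lambda>x. U x v) has_derivative UU v) (at z)"
  shows "ddc u z 1 \<i> = of_real ((UU 1 1 + UU \<i> \<i>) / 2)"
proof -
  have 1: "dc u x 1 = of_real (- U x \<i> / 2)" and i: "dc u x \<i> = of_real (U x 1 / 2)" if "x \<in> S" for x
    by (simp_all add: dc_def del_def delbar_def d_dz_of_real[OF U[OF that]] complex_eq_iff)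
  have di: "((\<lambda>x. dc u x \<i>) has_derivative (\<lambda>v. of_real (UU 1 v / 2))) (at z)"
  proof (rule has_derivative_transform_within_open[OF _ S])
    show "((\<lambda>x. complex_of_real (U x 1 / 2)) has_derivative (\<lambda>v. of_real (UU 1 v / 2))) (at z)"
      by (intro bounded_linear.has_derivative[OF bounded_linear_of_real]
          bounded_linear.has_derivative[OF bounded_linear_divide] UU)
  qed (simp add: i)
  have d1: "((\<lambda>x. dc u x 1) has_derivative (\<lambda>v. of_real (- UU \<i> v / 2))) (at z)"
  proof (rule has_derivative_transform_within_open[OF _ S])
    show "((\<lambda>x. complex_of_real (- U x \<i> / 2)) has_derivative (\<lambda>v. of_real (- UU \<i> v / 2))) (at z)"
      by (intro bounded_linear.has_derivative[OF bounded_linear_of_real]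
          bounded_linear.has_derivative[OF bounded_linear_divide] has_derivative_minus UU)
  qed (simp add: 1)
  show ?thesis
    unfolding ddc_def ext_deriv_def
    by (simp add: frechet_derivative_at[OF di, symmetric] frechet_derivative_at[OF d1, symmetric]
        add_divide_distrib)
qed

text \<open>
  The two Wirtinger derivatives of a real function are conjugate, so the product in the definition
  of the length is a squared modulus.
\<close>

lemma du_norm_squared:
  assumes "(u has_derivative U) (at z)" "lam z > 0"
  shows "(du_norm lam u z)\<^sup>2 = (norm ((of_real (U 1) - \<i> * of_real (U \<i>)) / 2))\<^sup>2 / lam z"
proof -
  have "Re ((of_real (U 1) - \<i> * of_real (U \<i>)) / 2 * ((of_real (U 1) + \<i> * of_real (U \<i>)) / 2))
     = (norm ((of_real (U 1) - \<i> * of_real (U \<i>)) / 2))\<^sup>2"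
    unfolding cmod_power2 by (simp add: power2_eq_square field_simps)
  then show ?thesis
    using assms(2) by (simp add: du_norm_def d_dz_of_real[OF assms(1)])
qed

lemma real_linear_on_complex:
  fixes D :: "complex \<Rightarrow> 'a::real_vector"
  assumes "linear D"
  shows "D v = Re v *\<^sub>R D 1 + Im v *\<^sub>R D \<i>"
proof -
  have "v = Re v *\<^sub>R 1 + Im v *\<^sub>R \<i>" by (simp add: complex_eq_iff)
  then have "D v = D (Re v *\<^sub>R 1 + Im v *\<^sub>R \<i>)" by (rule arg_cong)
  then show ?thesis using assms by (simp only: linear_add linear_cmul)
qed

lemma cauchy_riemann_has_field_derivative:
  fixes D :: "complex \<Rightarrow> complex"
  assumes "(f has_derivative D) (at z)" "D \<i> = \<i> * D 1"
  shows "(f has_field_derivative D 1) (at z)"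
proof -
  have "D v = D 1 * v" for v
  proof -
    have "D v = Re v *\<^sub>R D 1 + Im v *\<^sub>R D \<i>"
      by (rule real_linear_on_complex[OF has_derivative_linear[OF assms(1)]])
    also have "\<dots> = D 1 * (of_real (Re v) + \<i> * of_real (Im v))"
      using assms(2) by (simp add: scaleR_conv_of_real algebra_simps)
    finally show ?thesis by (simp only: complex_eq[symmetric])
  qed
  then have "D = (*) (D 1)" by (rule ext)
  then show ?thesis using assms(1) by (simp add: has_field_derivative_def)
qed

lemma one_minus_norm_squared: "complex_of_real (1 - (norm z)\<^sup>2) = 1 - z * cnj z"
  by (simp only: of_real_diff of_real_1 complex_norm_square)

section \<open>Solving the norm equation\<close>

lemma real_ball_islimpt: "0 < r \<Longrightarrow> 0 islimpt {x::complex. x \<in> \<real> \<and> norm x < r}"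
  unfolding islimpt_approachable
proof (intro allI impI)
  fix e :: real assume "0 < r" "0 < e"
  then show "\<exists>x'\<in>{x::complex. x \<in> \<real> \<and> norm x < r}. x' \<noteq> 0 \<and> dist x' 0 < e"
    by (intro bexI[of _ "of_real (min e r / 2)"]) (auto simp: min_def)
qed

text \<open>
  The points \<open>(z, cnj z)\<close> form a totally real plane, on which a holomorphic function of two
  variables is determined. In the coordinates \<open>x = (z + w) / 2\<close>, \<open>y = (z - w) / (2 \<i>)\<close> this plane
  consists of the real points, so the identity theorem, applied in \<open>x\<close> and then in \<open>y\<close>, gives the
  claim. The radius is halved because \<open>|x|, |y| < r/2\<close> keeps \<open>x \<plusminus> \<i> y\<close> inside the disc of
  radius \<open>r\<close>. Holomorphy of \<open>G\<close> in both variables jointly is expressed by the holomorphy of all its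
  compositions with holomorphic functions of one variable.
\<close>

lemma polarization:
  fixes G :: "complex \<Rightarrow> complex \<Rightarrow> complex"
  assumes hol: "\<And>f k S. \<lbrakk>f holomorphic_on S; k holomorphic_on S; f ` S \<subseteq> ball 0 r; k ` S \<subseteq> ball 0 r\<rbrakk>
      \<Longrightarrow> (\<lambda>x. G (f x) (k x)) holomorphic_on S"
    and zero: "\<And>z. z \<in> ball 0 r \<Longrightarrow> G z (cnj z) = 0"
    and z: "z \<in> ball 0 (r/2)" and w: "w \<in> ball 0 (r/2)"
  shows "G z w = 0"
proof -
  have r: "r > 0" using z norm_ge_zero[of z] by (auto simp del: norm_ge_zero)
  define g where "g = (\<lambda>x y. G (x + \<i> * y) (x - \<i> * y))"
  have in1: "norm (x + \<i> * y) < r" if "norm x < r/2" "norm y < r/2" for x y :: complex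
    using norm_triangle_ineq[of x "\<i> * y"] that by (simp add: norm_mult)
  have in2: "norm (x - \<i> * y) < r" if "norm x < r/2" "norm y < r/2" for x y :: complex
    using norm_triangle_ineq4[of x "\<i> * y"] that by (simp add: norm_mult)
  have holx: "(\<lambda>x. g x y) holomorphic_on ball 0 (r/2)" if "norm y < r/2" for y
    unfolding g_def using that by (intro hol holomorphic_intros) (auto intro!: in1 in2)
  have holy: "g x holomorphic_on ball 0 (r/2)" if "norm x < r/2" for x
    unfolding g_def using that by (intro hol holomorphic_intros) (auto intro!: in1 in2)
  let ?R = "{x::complex. x \<in> \<real> \<and> norm x < r/2}"
  have lim: "0 islimpt ?R" using r by (intro real_ball_islimpt) auto
  have real: "g x y = 0" if "x \<in> ?R" "y \<in> ?R" for x y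
  proof -
    have "x - \<i> * y = cnj (x + \<i> * y)" using that by (auto simp: Reals_cnj_iff)
    then show ?thesis using zero[of "x + \<i> * y"] in1[of x y] that by (simp add: g_def)
  qed
  have step: "g x y = 0" if "norm x < r/2" "y \<in> ?R" for x y
    by (rule analytic_continuation[of "\<lambda>x. g x y" "ball 0 (r/2)" ?R 0])
       (use that holx lim real r in auto)
  have all: "g x y = 0" if "norm x < r/2" "norm y < r/2" for x y
    by (rule analytic_continuation[of "g x" "ball 0 (r/2)" ?R 0])
       (use that holy lim step r in auto)
  have "norm ((z + w) / 2) < r/2"
    using norm_triangle_ineq[of z w] z w by (simp add: norm_divide)
  moreover have "norm ((z - w) / (2 * \<i>)) < r/2"
    using norm_triangle_ineq4[of z w] z w by (simp add: norm_divide norm_mult)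
  ultimately have "g ((z + w) / 2) ((z - w) / (2 * \<i>)) = 0" by (rule all)
  moreover have "(z + w) / 2 + \<i> * ((z - w) / (2 * \<i>)) = z" "(z + w) / 2 - \<i> * ((z - w) / (2 * \<i>)) = w"
    by (simp_all add: field_simps)
  ultimately show ?thesis by (simp add: g_def)
qed

text \<open>
  The squared modulus is the value at \<open>w = cnj z\<close> of a function \<open>G z w\<close> in which \<open>cnj (h z)\<close> is
  replaced by \<open>H w\<close>, with \<open>H = cnj \<circ> h \<circ> cnj\<close> holomorphic. Polarization at \<open>w = 0\<close> leaves a linear
  equation for \<open>h z\<close>.
\<close>

lemma constant_norm_solution:
  assumes hol: "h holomorphic_on ball 0 1"
    and eq: "\<And>z. norm z < 1 \<Longrightarrow> (norm (2 * cnj z + of_real (1 - (norm z)\<^sup>2) * h z))\<^sup>2 = C"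
  obtains a where "norm a = 1" "\<And>z. norm z < 1 \<Longrightarrow> 1 + a * z \<noteq> 0 \<and> h z = 2 * a / (1 + a * z)"
proof -
  define H where "H = cnj \<circ> h \<circ> cnj"
  have "cnj ` ball 0 1 = ball 0 1" by (auto simp: image_cnj_conv_vimage_cnj)
  with hol have holH: "H holomorphic_on ball 0 1"
    unfolding H_def by (intro holomorphic_on_compose_cnj_cnj) auto
  define G where "G = (\<lambda>z w. (2 * w + (1 - z * w) * h z) * (2 * z + (1 - z * w) * H w) - of_real C)"
  define b where "b = cnj (h 0)"
  have C: "C = (norm b)\<^sup>2" using eq[of 0] by (simp add: b_def)
  have near0: "(2 * z + b) * h z = of_real C" if "z \<in> ball 0 (1/2)" for z
  proof -
    have "G z 0 = 0"
    proof (rule polarization[where G = G and r = 1])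
      fix f k :: "complex \<Rightarrow> complex" and S
      assume *: "f holomorphic_on S" "k holomorphic_on S" "f ` S \<subseteq> ball 0 1" "k ` S \<subseteq> ball 0 1"
      have "(\<lambda>x. h (f x)) holomorphic_on S" "(\<lambda>x. H (k x)) holomorphic_on S"
        using holomorphic_on_compose_gen[OF *(1) hol *(3)] holomorphic_on_compose_gen[OF *(2) holH *(4)]
        by (simp_all add: o_def)
      then show "(\<lambda>x. G (f x) (k x)) holomorphic_on S"
        unfolding G_def using * by (intro holomorphic_intros)
    next
      fix z :: complex assume z: "z \<in> ball 0 1"
      let ?w = "2 * cnj z + of_real (1 - (norm z)\<^sup>2) * h z"
      note one_minus_norm_squared[of z]
      then have "G z (cnj z) = ?w * cnj ?w - of_real C"
        by (simp add: G_def H_def)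
      also have "\<dots> = 0"
        using eq[of z] z by (simp only: complex_norm_square[symmetric]) simp
      finally show "G z (cnj z) = 0" .
    qed (use that in auto)
    then show ?thesis by (simp add: G_def H_def b_def algebra_simps)
  qed
  \<comment> \<open>Polarization reaches only half the radius; analytic continuation gives the whole disc.\<close>
  have prod: "(2 * z + b) * h z = of_real C" if z: "norm z < 1" for z
  proof (rule analytic_continuation_open[where f = "\<lambda>z. (2 * z + b) * h z" and g = "\<lambda>_. of_real C"])
    show "(\<lambda>z. (2 * z + b) * h z) holomorphic_on ball 0 1"
      by (intro holomorphic_intros hol)
    show "ball 0 (1/2) \<subseteq> ball (0::complex) 1" by (rule subset_ball) simp
    show "ball (0::complex) (1/2) \<noteq> {}" by simp
  qed (use near0 z in simp_all)
  have "C \<noteq> 0"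
  proof
    assume "C = 0"
    with prod[of "1/2"] C have "h (1/2) = 0" by simp
    with eq[of "1/2"] \<open>C = 0\<close> show False by simp
  qed
  with C have b: "b \<noteq> 0" "norm b > 0" by auto
  have "C = 4"
  proof -
    \<comment> \<open>On the ray through \<open>b\<close> everything becomes real: at \<open>z = t b\<close> the equation is
      \<open>(2 t + (1 - t\<^sup>2 C) / (1 + 2 t))\<^sup>2 = 1\<close>. The bracket is positive, hence equal to 1, which
      amounts to \<open>4 t\<^sup>2 = t\<^sup>2 C\<close>. Any \<open>t > 0\<close> with \<open>t |b| < 1\<close> would do; this one gives \<open>t\<^sup>2 C = 1/4\<close>.\<close>
    define t where "t = 1 / (2 * norm b)"
    have t: "t > 0" "t * norm b = 1/2" using b by (auto simp: t_def)
    have n: "norm (of_real t * b) = 1/2" using t by (simp add: norm_mult)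
    have tC: "t\<^sup>2 * C = 1/4" unfolding C power_mult_distrib[symmetric] t(2) by (simp add: power2_eq_square)
    have "(b * of_real (1 + 2 * t)) * h (of_real t * b) = b * cnj b"
      using prod[of "of_real t * b"] n C complex_norm_square[of b] by (simp add: algebra_simps)
    then have "of_real (1 + 2 * t) * h (of_real t * b) = cnj b" using b by (simp add: mult.assoc)
    moreover have "complex_of_real (1 + 2 * t) \<noteq> 0" unfolding of_real_eq_0_iff using t by simp
    ultimately have h: "h (of_real t * b) = cnj b / of_real (1 + 2 * t)"
      by (metis nonzero_mult_div_cancel_left)
    have "2 * cnj (of_real t * b) + of_real (1 - (norm (of_real t * b))\<^sup>2) * h (of_real t * b)
        = of_real (2 * t + (3/4) / (1 + 2 * t)) * cnj b"
      unfolding h n by (simp add: power2_eq_square algebra_simps)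
    then have "(2 * t + (3/4) / (1 + 2 * t))\<^sup>2 * C = C"
      using eq[of "of_real t * b"] n C by (simp add: norm_mult power_mult_distrib del: of_real_add of_real_divide of_real_mult)
    then have "(2 * t + (3/4) / (1 + 2 * t))\<^sup>2 = 1\<^sup>2" using \<open>C \<noteq> 0\<close> by simp
    then have "2 * t + (3/4) / (1 + 2 * t) = 1"
      using t(1) by (subst (asm) power2_eq_iff_nonneg) auto
    then have "16 * t\<^sup>2 = 1" using t(1) by (simp add: field_simps power2_eq_square)
    then have "t\<^sup>2 = 1/16" by simp
    with tC show ?thesis by simp
  qed
  define a where "a = cnj b / 2"
  have "norm b = 2" using C \<open>C = 4\<close> by (intro power2_eq_imp_eq[of "norm b" 2]) auto
  then have a: "norm a = 1" by (simp add: a_def norm_divide)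
  have ba: "a * b = 2"
  proof -
    have "b * cnj b = of_real C" unfolding C by (rule complex_norm_square[symmetric])
    then show ?thesis using \<open>C = 4\<close> by (simp add: a_def mult.commute)
  qed
  show ?thesis
  proof
    fix z :: complex assume z: "norm z < 1"
    have "a * (2 * z + b) * h z = 4 * a"
      using prod[OF z] \<open>C = 4\<close> by simp
    also have "a * (2 * z + b) = 2 * (1 + a * z)" using ba by (simp add: algebra_simps)
    finally have "2 * ((1 + a * z) * h z) = 2 * (2 * a)" by (simp only: mult.assoc) simp
    then have *: "(1 + a * z) * h z = 2 * a" by (simp only: mult_cancel_left) simp
    then have "1 + a * z \<noteq> 0" using a by auto
    with * show "1 + a * z \<noteq> 0 \<and> h z = 2 * a / (1 + a * z)" by (simp add: field_simps)
  qed (rule a)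
qed

section \<open>The Cayley transform\<close>

lemma one_plus_unit_mult_nonzero:
  assumes "norm a = 1" "norm (z::complex) < 1"
  shows "1 + a * z \<noteq> 0" "Re (1 + a * z) > 0"
proof -
  have "\<bar>Re (a * z)\<bar> < 1"
    using abs_Re_le_cmod[of "a * z"] assms by (simp add: norm_mult)
  then show "Re (1 + a * z) > 0" by simp
  then show "1 + a * z \<noteq> 0" by (metis less_irrefl zero_complex.sel(1))
qed

text \<open>
  The real part comes from extending the fraction by \<open>cnj (1 + a z)\<close>, using \<open>|a| = 1\<close>. The inverse is
  \<open>w \<mapsto> cnj a (s + w) / (s - w)\<close>; it maps into the disc because a point \<open>w\<close> of the left half-plane is
  closer to \<open>-s\<close> than to \<open>s\<close>.
\<close>

lemma cayley_biholomorphism: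
  assumes a: "norm a = 1" and s: "s > 0"
  defines "F \<equiv> \<lambda>z. - of_real s * (1 - a * z) / (1 + a * z)"
  shows "biholomorphism F unit_disc left_half_plane"
    and "\<And>z. z \<in> unit_disc \<Longrightarrow> Re (F z) = - s * ((1 - (norm z)\<^sup>2) / (norm (1 + a * z))\<^sup>2)"
proof -
  have Re_F: "Re (F z) = - s * ((1 - (norm z)\<^sup>2) / (norm (1 + a * z))\<^sup>2)" if "z \<in> unit_disc" for z
  proof -
    have ne: "1 + a * z \<noteq> 0" using one_plus_unit_mult_nonzero a that by (auto simp: unit_disc_def)
    have "F z = - of_real s * ((1 - a * z) * cnj (1 + a * z)) / of_real ((norm (1 + a * z))\<^sup>2)"
      unfolding F_def complex_norm_square using ne
      by (simp only: complex_cnj_zero_iff mult.assoc[symmetric] mult_divide_mult_cancel_right not_False_eq_True)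
    then have "Re (F z) = - s * Re ((1 - a * z) * cnj (1 + a * z)) / (norm (1 + a * z))\<^sup>2"
      by (simp del: of_real_power)
    also have "Re ((1 - a * z) * cnj (1 + a * z)) = 1 - (norm (a * z))\<^sup>2"
      unfolding cmod_power2 by (simp add: power2_eq_square algebra_simps)
    finally show ?thesis using a by (simp add: norm_mult)
  qed
  then show "\<And>z. z \<in> unit_disc \<Longrightarrow> Re (F z) = - s * ((1 - (norm z)\<^sup>2) / (norm (1 + a * z))\<^sup>2)" .
  define K where "K = (\<lambda>w. cnj a * ((of_real s + w) / (of_real s - w)))"
  have aa: "a * cnj a = 1" using complex_norm_square[of a] a by simp
  have neK: "of_real s - w \<noteq> 0" if "w \<in> left_half_plane" for w
    using that s by (auto simp: left_half_plane_def complex_eq_iff)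
  have KF: "K (F z) = z" if "z \<in> unit_disc" for z
  proof -
    have ne: "1 + a * z \<noteq> 0" using one_plus_unit_mult_nonzero a that by (auto simp: unit_disc_def)
    have p: "of_real s + F z = 2 * of_real s * (a * z) / (1 + a * z)"
      and m: "of_real s - F z = 2 * of_real s / (1 + a * z)"
      using ne by (simp_all add: F_def field_simps)
    have "(of_real s + F z) / (of_real s - F z) = a * z"
      unfolding p m using ne s by simp
    then have "K (F z) = (a * cnj a) * z" by (simp only: K_def mult.assoc mult.left_commute)
    then show ?thesis using aa by simp
  qed
  have FK: "F (K w) = w" if "w \<in> left_half_plane" for w
  proof -
    have "a * K w = (of_real s + w) / (of_real s - w)"
      using aa by (simp add: K_def mult.assoc[symmetric])
    then have p: "1 + a * K w = 2 * of_real s / (of_real s - w)"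
      and m: "1 - a * K w = - 2 * w / (of_real s - w)"
      using neK[OF that] by (simp_all add: field_simps)
    show ?thesis unfolding F_def p m using neK[OF that] s by simp
  qed
  have F_in: "F z \<in> left_half_plane" if "z \<in> unit_disc" for z
  proof -
    have "(norm z)\<^sup>2 < 1" using that by (simp add: unit_disc_def power_less_one_iff)
    moreover have "1 + a * z \<noteq> 0" using one_plus_unit_mult_nonzero a that by (auto simp: unit_disc_def)
    ultimately show ?thesis using Re_F[OF that] s by (simp add: left_half_plane_def)
  qed
  have K_in: "K w \<in> unit_disc" if "w \<in> left_half_plane" for w
  proof -
    have "(norm (of_real s + w))\<^sup>2 < (norm (of_real s - w))\<^sup>2"
      unfolding cmod_power2 using that s mult_pos_neg[of s "Re w"]
      by (simp add: left_half_plane_def power2_eq_square algebra_simps)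
    then have "norm (of_real s + w) < norm (of_real s - w)" by (rule power_less_imp_less_base) simp
    then show ?thesis using neK[OF that] a
      by (simp add: unit_disc_def K_def norm_mult norm_divide)
  qed
  have bij: "bij_betw F unit_disc left_half_plane"
    using KF FK F_in K_in by (intro bij_betw_byWitness[of _ K]) auto
  have "inv_into unit_disc F w = K w" if "w \<in> left_half_plane" for w
    using bij K_in[OF that] FK[OF that] by (metis bij_betw_def inv_into_f_f)
  moreover have "K holomorphic_on left_half_plane"
    unfolding K_def by (intro holomorphic_intros neK)
  ultimately have "inv_into unit_disc F holomorphic_on left_half_plane"
    by (metis holomorphic_transform)
  moreover have "F holomorphic_on unit_disc"
    unfolding F_def using one_plus_unit_mult_nonzero a
    by (intro holomorphic_intros) (auto simp: unit_disc_def)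
  ultimately show "biholomorphism F unit_disc left_half_plane"
    using bij by (simp add: biholomorphism_def)
qed

section \<open>Potentials on the disc\<close>

text \<open>
  Here \<open>U\<close> stands for the differential of a potential \<open>u\<close> and \<open>UU\<close> for its second derivatives.
  The Cauchy-Riemann defect \<open>\<i> D 1 - D \<i>\<close> is \<open>2 \<i>\<close> times the \<open>cnj z\<close>-derivative. For \<open>u\<^sub>z\<close> it is
  \<open>\<i>/2\<close> times the Laplacian of \<open>u\<close>, once the mixed derivatives cancel, and for \<open>2 cnj z / \<rho>\<close> with
  \<open>\<rho> = 1 - |z|\<^sup>2\<close> it is \<open>4 \<i> / \<rho>\<^sup>2\<close>; the hypothesis on the Laplacian makes them agree.
\<close>

lemma holomorphic_part_of_potential:
  assumes UU: "\<And>z v. norm z < 1 \<Longrightarrow> ((\<lambda>x. U x v) has_derivative UU v z) (at z)"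
    and sym: "\<And>z. norm z < 1 \<Longrightarrow> UU 1 z \<i> = UU \<i> z (1::complex)"
    and lap: "\<And>z. norm z < 1 \<Longrightarrow> UU 1 z 1 + UU \<i> z \<i> = (8::real) / (1 - (norm z)\<^sup>2)\<^sup>2"
  shows "(\<lambda>z. (of_real (U z 1) - \<i> * of_real (U z \<i>)) / 2 - 2 * cnj z / (1 - z * cnj z))
    holomorphic_on ball 0 1" (is "?h holomorphic_on _")
proof (rule holomorphic_onI)
  fix z :: complex assume "z \<in> ball 0 1"
  then have z: "norm z < 1" by simp
  note \<rho> = one_minus_norm_squared[of z, symmetric]
  have "(norm z)\<^sup>2 < 1" using z by (simp add: power_less_one_iff)
  then have ne: "1 - z * cnj z \<noteq> 0" unfolding \<rho> by (metis diff_gt_0_iff_gt less_irrefl of_real_eq_0_iff)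
  define D where "D = (\<lambda>v. (of_real (UU 1 z v) - \<i> * of_real (UU \<i> z v)) / 2
     - (2 * cnj v + 2 * (cnj z)\<^sup>2 * v) / (1 - z * cnj z)\<^sup>2)"
  have of_real_U: "((\<lambda>x. complex_of_real (U x v)) has_derivative (\<lambda>w. of_real (UU v z w))) (at z)" for v
    by (rule bounded_linear.has_derivative[OF bounded_linear_of_real UU[OF z]])
  have cnj: "(cnj has_derivative cnj) (at z)"
    by (rule bounded_linear_imp_has_derivative[OF bounded_linear_cnj])
  have "((\<lambda>z. 1 - z * cnj z) has_derivative (\<lambda>v. - (z * cnj v + v * cnj z))) (at z)"
    using has_derivative_diff[OF has_derivative_const has_derivative_mult[OF has_derivative_ident cnj]]
    by simp
  from has_derivative_divide'[OF has_derivative_mult_right[OF cnj] this ne, of 2]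
  have dp: "((\<lambda>z. 2 * cnj z / (1 - z * cnj z)) has_derivative
      (\<lambda>v. (2 * cnj v + 2 * (cnj z)\<^sup>2 * v) / (1 - z * cnj z)\<^sup>2)) (at z)"
    by (simp add: algebra_simps power2_eq_square)
  have "(?h has_derivative D) (at z)"
    unfolding D_def
    by (intro has_derivative_diff dp bounded_linear.has_derivative[OF bounded_linear_divide]
        has_derivative_mult_right of_real_U)
  moreover have "D \<i> = \<i> * D 1"
  proof -
    have "\<i> * D 1 - D \<i> = \<i> / 2 * of_real (UU 1 z 1 + UU \<i> z \<i>)
      - 4 * \<i> / (1 - z * cnj z)\<^sup>2"
      unfolding D_def using sym[OF z]
      by (simp add: algebra_simps add_divide_distrib diff_divide_distrib)
    also have "of_real (UU 1 z 1 + UU \<i> z \<i>) = 8 / (1 - z * cnj z)\<^sup>2"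
      unfolding lap[OF z] \<rho> by simp
    finally show ?thesis by simp
  qed
  ultimately have "(?h has_field_derivative D 1) (at z)"
    by (rule cauchy_riemann_has_field_derivative)
  then show "?h field_differentiable at z within ball 0 1"
    using field_differentiable_def field_differentiable_at_within by blast
qed

text \<open>
  A real function is determined up to a constant by its \<open>z\<close>-derivative, because its differential is
  \<open>v \<mapsto> 2 Re (u\<^sub>z v)\<close>. The function \<open>ln |1 + a z|\<close> is differentiated as the real part of the
  principal logarithm, which is holomorphic here as \<open>1 + a z\<close> has positive real part.
\<close>

lemma integrate_potential:
  fixes u :: "complex \<Rightarrow> real"
  assumes a: "norm a = 1"
    and U: "\<And>z. norm z < 1 \<Longrightarrow> (u has_derivative U z) (at z)"
    and g: "\<And>z. norm z < 1 \<Longrightarrow>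
      (of_real (U z 1) - \<i> * of_real (U z \<i>)) / 2 = 2 * a / (1 + a * z) + 2 * cnj z / (1 - z * cnj z)"
  obtains c where "\<And>z. norm z < 1 \<Longrightarrow> u z = c + 4 * ln (norm (1 + a * z)) - 2 * ln (1 - (norm z)\<^sup>2)"
proof -
  define k where "k = (\<lambda>z. u z + 2 * ln (1 - Re (z * cnj z)) - 4 * Re (Ln (1 + a * z)))"
  have sq: "Re (z * cnj z) = (norm z)\<^sup>2" for z :: complex
    by (metis Re_complex_of_real complex_norm_square)
  have "(k has_derivative (\<lambda>v. 0)) (at z within ball 0 1)" if "z \<in> ball 0 1" for z
  proof -
    have z: "norm z < 1" using that by simp
    have pos: "1 - Re (z * cnj z) > 0" unfolding sq using z by (simp add: power_less_one_iff)
    have R: "Re (1 + a * z) > 0" using one_plus_unit_mult_nonzero(2)[OF a z] .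
    have nR: "1 + a * z \<notin> \<real>\<^sub>\<le>\<^sub>0" using R by (metis complex_nonpos_Reals_iff not_le)
    have Uv: "U z v = 2 * Re (((of_real (U z 1) - \<i> * of_real (U z \<i>)) / 2) * v)" for v
      using real_linear_on_complex[OF has_derivative_linear[OF U[OF z]], of v] by simp
    have dLn: "((\<lambda>z. Ln (1 + a * z)) has_derivative (\<lambda>v. a / (1 + a * z) * v)) (at z)"
      unfolding has_field_derivative_def[symmetric]
      by (rule derivative_eq_intros refl nR | simp add: divide_inverse mult.commute)+
    have cnj: "(cnj has_derivative cnj) (at z)"
      by (rule bounded_linear_imp_has_derivative[OF bounded_linear_cnj])
    have d\<rho>: "((\<lambda>z. 1 - Re (z * cnj z)) has_derivative (\<lambda>v. - 2 * Re (cnj z * v))) (at z)"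
      by (rule derivative_eq_intros cnj refl | simp)+
         (auto simp: fun_eq_iff algebra_simps)
    have dln: "((\<lambda>z. ln (1 - Re (z * cnj z))) has_derivative
        (\<lambda>v. - 2 * Re (cnj z * v) / (1 - Re (z * cnj z)))) (at z)"
      using has_derivative_ln[OF pos d\<rho>] by (simp only: divide_inverse)
    have "(k has_derivative (\<lambda>v. U z v + 2 * (- 2 * Re (cnj z * v) / (1 - Re (z * cnj z)))
        - 4 * Re (a / (1 + a * z) * v))) (at z)"
      unfolding k_def
      by (intro has_derivative_add has_derivative_diff has_derivative_mult_right
          bounded_linear.has_derivative[OF bounded_linear_Re] U[OF z] dln dLn)
    moreover have "U z v + 2 * (- 2 * Re (cnj z * v) / (1 - Re (z * cnj z)))
        - 4 * Re (a / (1 + a * z) * v) = 0" for v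
    proof -
      have "1 - z * cnj z = of_real (1 - Re (z * cnj z))" by (simp only: sq one_minus_norm_squared)
      then have "2 * cnj z / (1 - z * cnj z) * v = of_real 2 * (cnj z * v) / of_real (1 - Re (z * cnj z))"
        by (simp only: of_real_numeral times_divide_eq_left mult.assoc)
      then have "Re (2 * cnj z / (1 - z * cnj z) * v) = 2 * Re (cnj z * v) / (1 - Re (z * cnj z))"
        by (simp only: Re_divide_of_real) simp
      moreover have "Re (2 * a / (1 + a * z) * v) = 2 * Re (a / (1 + a * z) * v)"
      proof -
        have "2 * a / (1 + a * z) * v = a / (1 + a * z) * v + a / (1 + a * z) * v" by simp
        then show ?thesis by (simp only: plus_complex.sel)
      qed
      ultimately show ?thesis
        unfolding Uv[of v] g[OF z] by (simp only: distrib_right plus_complex.sel) (simp flip: add_divide_distrib)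
    qed
    ultimately show ?thesis by (simp add: has_derivative_at_withinI)
  qed
  then obtain c where c: "\<And>z. z \<in> ball 0 1 \<Longrightarrow> k z = c"
    using has_derivative_zero_constant[OF convex_ball] by metis
  show ?thesis
  proof
    fix z :: complex assume z: "norm z < 1"
    have "Re (Ln (1 + a * z)) = ln (norm (1 + a * z))"
      by (rule Re_Ln) (rule one_plus_unit_mult_nonzero(1)[OF a z])
    moreover have "k z = c" using c z by simp
    ultimately show "u z = c + 4 * ln (norm (1 + a * z)) - 2 * ln (1 - (norm z)\<^sup>2)"
      unfolding k_def sq by simp
  qed
qed

section \<open>Characterization of the half-plane potential\<close>

theorem theorem1p2:
  fixes \<phi> :: "complex \<Rightarrow> real"
  assumes smooth: "smooth_on \<phi> unit_disc"
    and pos: "\<forall>z\<in>unit_disc. \<phi> z > 0"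
    and ddc_eq: "\<forall>z\<in>unit_disc. \<forall>v w.
      ddc (\<lambda>x. ln (\<phi> x)) z v w = 2 * metric_form lambda_disc z v w"
    and const: "du_norm lambda_disc (\<lambda>x. ln (\<phi> x)) constant_on unit_disc"
  shows "(\<exists>F. biholomorphism F unit_disc left_half_plane \<and>
              (\<forall>z\<in>unit_disc. \<phi> z = lambda_half_plane (F z)))
       \<and> (\<exists>(r::real) (\<theta>::real). r > 0 \<and>
              (\<forall>z\<in>unit_disc.
                 \<phi> z = r * (norm (1 + exp (\<i> * of_real \<theta>) * z) ^ 4 / (1 - (norm z)\<^sup>2)\<^sup>2)))"
proof -
  have disc: "z \<in> unit_disc \<longleftrightarrow> norm z < 1" for z by (simp add: unit_disc_def)
  have op: "open unit_disc"
  proof -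
    have "unit_disc = ball 0 1" by (auto simp: disc)
    then show ?thesis by (metis open_ball)
  qed
  define P where "P = (\<lambda>x. frechet_derivative \<phi> (at x))"
  define PP where "PP = (\<lambda>v x. frechet_derivative (\<lambda>x. P x v) (at x))"
  have P: "(\<phi> has_derivative P z) (at z)" if "z \<in> unit_disc" for z
    unfolding P_def by (rule smooth_on_first_derivative[OF smooth that])
  have smP: "smooth_on (\<lambda>x. P x v) unit_disc" for v
    unfolding P_def by (rule smooth_on_derivative[OF smooth])
  have PP: "((\<lambda>x. P x v) has_derivative PP v z) (at z)" if "z \<in> unit_disc" for z v
    unfolding PP_def by (rule smooth_on_first_derivative[OF smP that])
  have contPP: "continuous_on unit_disc (\<lambda>x. PP v x w)" for v w
    unfolding PP_def by (rule smooth_on_imp_continuous_on[OF smooth_on_derivative[OF smP]])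
  have symPP: "PP v z w = PP w z v" if "z \<in> unit_disc" for z v w
    by (rule second_derivative_symmetric[OF op that P PP PP contPP contPP])
  define u where "u = (\<lambda>x. ln (\<phi> x))"
  define U where "U = (\<lambda>z v. P z v / \<phi> z)"
  define UU where "UU = (\<lambda>v z w. PP v z w / \<phi> z - P z v * P z w / (\<phi> z)\<^sup>2)"
  have U: "(u has_derivative U z) (at z)" if "z \<in> unit_disc" for z
    unfolding u_def U_def using has_derivative_ln[OF _ P[OF that]] pos that by (simp add: divide_inverse mult.commute)
  have UU: "((\<lambda>x. U x v) has_derivative UU v z) (at z)" if "z \<in> unit_disc" for z v
  proof -
    have "\<phi> z > 0" using pos that by blast
    then show ?thesis
      unfolding U_def UU_def
      by (auto intro!: derivative_eq_intros P PP that simp: fun_eq_iff field_simps power2_eq_square)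
  qed
  have symUU: "UU v z w = UU w z v" if "z \<in> unit_disc" for z v w
    unfolding UU_def using symPP[OF that] by (simp add: mult.commute)
  have sq1: "(norm z)\<^sup>2 < 1" if "norm z < 1" for z :: complex
    using that by (simp add: power_less_one_iff)
  have lam: "lambda_disc z = 1 / (1 - (norm z)\<^sup>2)\<^sup>2" for z
    by (simp add: lambda_disc_def power_int_minus divide_inverse)
  have lap: "UU 1 z 1 + UU \<i> z \<i> = 8 / (1 - (norm z)\<^sup>2)\<^sup>2" if "norm z < 1" for z
  proof -
    have z: "z \<in> unit_disc" using that by (simp add: disc)
    have "complex_of_real ((UU 1 z 1 + UU \<i> z \<i>) / 2) = ddc u z 1 \<i>"
      by (rule ddc_coefficient[OF op z U UU[OF z], symmetric])
    also have "\<dots> = 2 * metric_form lambda_disc z 1 \<i>"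
      unfolding u_def using ddc_eq z by blast
    also have "\<dots> = of_real (4 * lambda_disc z)"
      by (simp add: metric_form_def dz_wedge_dzbar_def)
    finally show ?thesis unfolding of_real_eq_iff lam by simp
  qed
  define h where "h = (\<lambda>z. (of_real (U z 1) - \<i> * of_real (U z \<i>)) / 2 - 2 * cnj z / (1 - z * cnj z))"
  have hol: "h holomorphic_on ball 0 1"
    unfolding h_def by (rule holomorphic_part_of_potential[OF UU symUU lap]) (auto simp: disc)
  obtain K where K: "\<And>z. z \<in> unit_disc \<Longrightarrow> du_norm lambda_disc u z = K"
    using const unfolding constant_on_def u_def by blast
  \<comment> \<open>By the definition of \<open>h\<close> the left side is the square of the modulus of \<open>(1 - |z|\<^sup>2) u\<^sub>z\<close>,
    which is the length of \<open>du\<close>.\<close>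
  have eq: "(norm (2 * cnj z + of_real (1 - (norm z)\<^sup>2) * h z))\<^sup>2 = K\<^sup>2" if "norm z < 1" for z
  proof -
    let ?g = "(of_real (U z 1) - \<i> * of_real (U z \<i>)) / 2"
    have z: "z \<in> unit_disc" using that by (simp add: disc)
    have \<rho>: "1 - (norm z)\<^sup>2 > 0" using sq1[OF that] by simp
    note \<rho>' = one_minus_norm_squared[of z]
    have ne: "1 - z * cnj z \<noteq> 0" unfolding \<rho>'[symmetric] of_real_eq_0_iff using \<rho> by simp
    have "2 * cnj z + of_real (1 - (norm z)\<^sup>2) * h z = of_real (1 - (norm z)\<^sup>2) * ?g"
      unfolding h_def \<rho>' right_diff_distrib using ne by simp
    then have "(norm (2 * cnj z + of_real (1 - (norm z)\<^sup>2) * h z))\<^sup>2 = (1 - (norm z)\<^sup>2)\<^sup>2 * (norm ?g)\<^sup>2"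
      by (simp only: norm_mult norm_of_real power_mult_distrib power2_abs)
    also have "\<dots> = (norm ?g)\<^sup>2 / lambda_disc z" by (simp add: lam mult.commute)
    also have "\<dots> = (du_norm lambda_disc u z)\<^sup>2"
      using \<rho> by (intro du_norm_squared[OF U[OF z], symmetric]) (simp add: lam)
    finally show ?thesis using K[OF z] by simp
  qed
  obtain a where a: "norm a = 1" and ha: "\<And>z. norm z < 1 \<Longrightarrow> 1 + a * z \<noteq> 0 \<and> h z = 2 * a / (1 + a * z)"
    using constant_norm_solution[OF hol eq] by blast
  obtain c where c: "\<And>z. norm z < 1 \<Longrightarrow> u z = c + 4 * ln (norm (1 + a * z)) - 2 * ln (1 - (norm z)\<^sup>2)"
  proof (rule integrate_potential[OF a])
    show "(u has_derivative U z) (at z)" if "norm z < 1" for z using U that by (simp add: disc)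
    show "(of_real (U z 1) - \<i> * of_real (U z \<i>)) / 2 = 2 * a / (1 + a * z) + 2 * cnj z / (1 - z * cnj z)"
      if "norm z < 1" for z
      using ha[OF that] unfolding h_def by (metis diff_add_cancel)
  qed blast
  have \<phi>: "\<phi> z = exp c * (norm (1 + a * z) ^ 4 / (1 - (norm z)\<^sup>2)\<^sup>2)" if "z \<in> unit_disc" for z
  proof -
    have z: "norm z < 1" using that by (simp add: disc)
    have n: "norm (1 + a * z) > 0" using ha[OF z] by simp
    have \<rho>: "1 - (norm z)\<^sup>2 > 0" using sq1[OF z] by simp
    have "\<phi> z = exp (u z)" using pos that by (simp add: u_def)
    also have "\<dots> = exp c * (exp (ln (norm (1 + a * z))) ^ 4 / (exp (ln (1 - (norm z)\<^sup>2)))\<^sup>2)"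
      unfolding c[OF z] by (simp add: exp_diff exp_add exp_of_nat_mult[symmetric])
    finally show ?thesis using n \<rho> by (simp only: exp_ln)
  qed
  obtain \<theta> where \<theta>: "a = exp (\<i> * of_real \<theta>)"
    using a complex_norm_eq_1_exp by metis
  \<comment> \<open>\<open>lambda_half_plane\<close> is homogeneous of degree \<open>-2\<close>, so scaling by \<open>s\<close> yields the factor
    \<open>s powi (-2) = exp c\<close>.\<close>
  define s where "s = exp (- c / 2)"
  have s: "s > 0" by (simp add: s_def)
  have s2: "1 / s\<^sup>2 = exp c" by (simp add: s_def power2_eq_square exp_minus field_simps flip: exp_add)
  let ?F = "\<lambda>z. - of_real s * (1 - a * z) / (1 + a * z)"
  have "\<phi> z = lambda_half_plane (?F z)" if "z \<in> unit_disc" for z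
  proof -
    have "lambda_half_plane (?F z) = 1 / (s\<^sup>2 * ((1 - (norm z)\<^sup>2)\<^sup>2 / norm (1 + a * z) ^ 4))"
      unfolding lambda_half_plane_def cayley_biholomorphism(2)[OF a s that]
      by (simp add: power_mult_distrib power_divide flip: power_mult)
    also have "\<dots> = 1 / s\<^sup>2 * (norm (1 + a * z) ^ 4 / (1 - (norm z)\<^sup>2)\<^sup>2)" by simp
    finally show ?thesis unfolding s2 \<phi>[OF that] by simp
  qed
  then have "\<exists>F. biholomorphism F unit_disc left_half_plane \<and>
      (\<forall>z\<in>unit_disc. \<phi> z = lambda_half_plane (F z))"
    using cayley_biholomorphism(1)[OF a s] by blast
  moreover have "\<exists>(r::real) (\<theta>::real). r > 0 \<and> (\<forall>z\<in>unit_disc.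
      \<phi> z = r * (norm (1 + exp (\<i> * of_real \<theta>) * z) ^ 4 / (1 - (norm z)\<^sup>2)\<^sup>2))"
    using \<phi> unfolding \<theta> by (intro exI[of _ "exp c"] exI[of _ \<theta>]) auto
  ultimately show ?thesis ..
qed

end
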